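(* For every integer $n\ge 1$, the determinantal variety $X_n=\{A\in\mathbb{R}^{n^2} : \det(A)=0\}$ is normally embedded, i.e. the intrinsic and extrinsic metrics on $X_n$ are bilipschitz equivalent: there is a constant $C=C(n)$ such that for all $A,B\in X_n$, $$d_{ext}(A,B)\le d_{int}(A,B)\le C\,d_{ext}(A,B).$$
   Context: $\mathbb{R}^{n^2}$ is the space of real $n\times n$ matrices with its Euclidean metric (the squared norm is the sum of squares of the entries). For $A,B\in X_n$, the extrinsic distance is $d_{ext}(A,B)=\|A-B\|$, and the intrinsic distance $d_{int}(A,B)$ is the infimum of the Euclidean lengths of all (rectifiable) paths from $A$ to $B$ contained in $X_n$. *)

theory Defs
  imports "HOL-Analysis.Analysis"
begin

text \<open>
  Length of a curve \<open>g\<close> on \<open>{0..1}\<close>: supremum over all finite partitions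
  \<open>0 = t 0 \<le> t 1 \<le> \<dots> \<le> t m = 1\<close>. The values of \<open>t\<close> beyond \<open>m\<close> are irrelevant.
\<close>

definition path_length :: "(real \<Rightarrow> 'a::metric_space) \<Rightarrow> ennreal" where
  "path_length g =
    (SUP (m, t) \<in> {(m::nat, t::nat \<Rightarrow> real). t 0 = 0 \<and> t m = 1 \<and> (\<forall>i<m. t i \<le> t (Suc i))}.
      \<Sum>i<m. ennreal (dist (g (t i)) (g (t (Suc i)))))"

definition rectifiable_path :: "(real \<Rightarrow> 'a::metric_space) \<Rightarrow> bool" where
  "rectifiable_path g \<longleftrightarrow> path g \<and> path_length g < \<infinity>"

text \<open>
  The infimum is taken in \<open>ennreal\<close>, so it is \<open>\<infinity>\<close> when no rectifiable path in \<open>X\<close>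
  joins \<open>A\<close> to \<open>B\<close>; a finite upper bound therefore includes the existence of such a path.
\<close>

definition intrinsic_dist :: "'a::metric_space set \<Rightarrow> 'a \<Rightarrow> 'a \<Rightarrow> ennreal" where
  "intrinsic_dist X A B =
    (INF g \<in> {g. rectifiable_path g \<and> path_image g \<subseteq> X \<and> pathstart g = A \<and> pathfinish g = B}.
      path_length g)"

definition normally_embedded :: "'a::metric_space set \<Rightarrow> bool" where
  "normally_embedded X \<longleftrightarrow>
    (\<exists>C::real. 0 < C \<and>
      (\<forall>A\<in>X. \<forall>B\<in>X. ennreal (dist A B) \<le> intrinsic_dist X A B \<and>
        intrinsic_dist X A B \<le> ennreal (C * dist A B)))"

definition determinantal_variety :: "(real^'n^'n) set" where
  "determinantal_variety = {A. det A = 0}"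

text \<open>The library metric on \<open>real^'n^'n\<close> is the Euclidean one on the entries.\<close>

lemma norm_matrix_squared:
  fixes A :: "real^'n^'n"
  shows "(norm A)\<^sup>2 = (\<Sum>i\<in>UNIV. \<Sum>j\<in>UNIV. (A $ i $ j)\<^sup>2)"
  by (simp add: norm_vec_def L2_set_def sum_nonneg)

end

theory Submission
  imports Defs
begin

text \<open>
  Two singular matrices \<open>A\<close> and \<open>B\<close> are joined inside the determinantal variety by two segments.
  Choose a unit vector \<open>v\<close> with \<open>B v = 0\<close> and let \<open>A' = A (I - v v\<^sup>T)\<close>, that is, \<open>A\<close> with
  the component along \<open>v\<close> removed from every row.
  \<^item> On the segment from \<open>A\<close> to \<open>A'\<close> every matrix has the form \<open>A (I - s v v\<^sup>T)\<close>, so it is singular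
    because its left factor is.
  \<^item> On the segment from \<open>A'\<close> to \<open>B\<close> every matrix kills \<open>v\<close>, because both endpoints do.

  As \<open>B v = 0\<close>, the rows of \<open>A - A'\<close> and of \<open>A' - B\<close> are the orthogonal projections of the rows
  of \<open>A - B\<close> to the line of \<open>v\<close> and to its complement. Hence neither segment is longer than
  \<open>norm (A - B)\<close>, and \<open>C = 2\<close> works for every size of the matrices.
\<close>

section \<open>Length and intrinsic distance\<close>

lemma dist_le_path_length: "ennreal (dist (g 0) (g 1)) \<le> path_length g"
proof -
  \<comment> \<open>With one step, the function \<open>real\<close> is itself a partition of the unit interval.\<close>
  have "(\<Sum>i<(1::nat). ennreal (dist (g (real i)) (g (real (Suc i))))) \<le> path_length g"
    unfolding path_length_def by (rule SUP_upper2[where i = "(1, real)"]) auto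
  then show ?thesis by simp
qed

lemma dist_le_intrinsic_dist: "ennreal (dist A B) \<le> intrinsic_dist X A B"
  unfolding intrinsic_dist_def
proof (rule INF_greatest)
  fix g assume "g \<in> {g. rectifiable_path g \<and> path_image g \<subseteq> X \<and> pathstart g = A \<and> pathfinish g = B}"
  then show "ennreal (dist A B) \<le> path_length g"
    using dist_le_path_length[of g] by (auto simp: pathstart_def pathfinish_def)
qed

lemma path_length_le_lipschitz:
  fixes g :: "real \<Rightarrow> 'a::metric_space"
  assumes L: "L-lipschitz_on {0..1} g"
  shows "path_length g \<le> ennreal L"
  unfolding path_length_def
proof (rule SUP_least, clarify)
  fix m :: nat and t :: "nat \<Rightarrow> real"
  assume t: "t 0 = 0" "t m = 1" "\<forall>i<m. t i \<le> t (Suc i)"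
  have mono: "t i \<le> t j" if "i \<le> j" "j \<le> m" for i j
    using that by (induction rule: dec_induct) (use t(3) in \<open>auto intro: order_trans\<close>)
  have t01: "t i \<in> {0..1}" if "i \<le> m" for i
    using mono[of 0 i] mono[of i m] that t by auto
  have "(\<Sum>i<m. dist (g (t i)) (g (t (Suc i)))) \<le> (\<Sum>i<m. L * (t (Suc i) - t i))"
  proof (rule sum_mono)
    fix i assume "i \<in> {..<m}"
    then show "dist (g (t i)) (g (t (Suc i))) \<le> L * (t (Suc i) - t i)"
      using lipschitz_onD[OF L t01[of i] t01[of "Suc i"]] t(3) by (auto simp: dist_real_def)
  qed
  also have "\<dots> = L"
    using sum_lessThan_telescope[of t m] t by (simp flip: sum_distrib_left)
  finally show "(\<Sum>i<m. ennreal (dist (g (t i)) (g (t (Suc i))))) \<le> ennreal L"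
    by (simp add: sum_ennreal ennreal_leI)
qed

lemma intrinsic_dist_le_lipschitz:
  assumes "L-lipschitz_on {0..1} g" "path_image g \<subseteq> X" "pathstart g = A" "pathfinish g = B"
  shows "intrinsic_dist X A B \<le> ennreal L"
proof -
  have len: "path_length g \<le> ennreal L"
    using assms(1) by (rule path_length_le_lipschitz)
  moreover have "path g"
    unfolding path_def using assms(1) by (rule lipschitz_on_continuous_on)
  ultimately have "rectifiable_path g"
    unfolding rectifiable_path_def using le_less_trans[OF _ ennreal_less_top] by auto
  then have "intrinsic_dist X A B \<le> path_length g"
    unfolding intrinsic_dist_def using assms by (intro INF_lower) auto
  with len show ?thesis by (rule order_trans[rotated])
qed

lemma lipschitz_on_linepath:
  fixes a b :: "'a::real_normed_vector"
  shows "(dist a b)-lipschitz_on S (linepath a b)"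
proof (rule lipschitz_onI)
  fix x y :: real
  have "linepath a b x - linepath a b y = (y - x) *\<^sub>R (a - b)"
    by (simp add: linepath_def algebra_simps)
  then show "dist (linepath a b x) (linepath a b y) \<le> dist a b * dist x y"
    by (simp add: dist_norm abs_minus_commute mult.commute)
qed simp

text \<open>The factor 2 comes from the speed-up of both halves when paths are joined.\<close>

lemma lipschitz_on_joinpaths:
  assumes g: "L-lipschitz_on {0..1} g" and h: "L-lipschitz_on {0..1} h"
    and "pathfinish g = pathstart h"
  shows "(2 * L)-lipschitz_on {0..1} (g +++ h)"
proof -
  have double: "dist (2 * x - c) (2 * y - c) = 2 * dist x y" for x y c :: real
    by (simp add: dist_real_def abs_if)
  show ?thesis
    unfolding joinpaths_def
  proof (rule lipschitz_on_concat)
    show "(2 * L)-lipschitz_on {0..1/2} (\<lambda>x. g (2 * x))"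
    proof (rule lipschitz_onI)
      fix x y :: real assume "x \<in> {0..1/2}" "y \<in> {0..1/2}"
      then show "dist (g (2 * x)) (g (2 * y)) \<le> 2 * L * dist x y"
        using lipschitz_onD[OF g, of "2 * x" "2 * y"] double[where x = x and y = y and c = 0] by simp
    qed (use lipschitz_on_nonneg[OF g] in simp)
    show "(2 * L)-lipschitz_on {1/2..1} (\<lambda>x. h (2 * x - 1))"
    proof (rule lipschitz_onI)
      fix x y :: real assume "x \<in> {1/2..1}" "y \<in> {1/2..1}"
      then show "dist (h (2 * x - 1)) (h (2 * y - 1)) \<le> 2 * L * dist x y"
        using lipschitz_onD[OF h, of "2 * x - 1" "2 * y - 1"] double[where x = x and y = y and c = 1] by simp
    qed (use lipschitz_on_nonneg[OF h] in simp)
  qed (use assms(3) in \<open>simp add: pathfinish_def pathstart_def\<close>)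
qed

lemma intrinsic_dist_two_segments:
  fixes A B M :: "'a::real_normed_vector"
  assumes "closed_segment A M \<subseteq> X" "closed_segment M B \<subseteq> X" "dist A M \<le> d" "dist M B \<le> d"
  shows "intrinsic_dist X A B \<le> ennreal (2 * d)"
proof (rule intrinsic_dist_le_lipschitz)
  show "(2 * d)-lipschitz_on {0..1} (linepath A M +++ linepath M B)"
    using assms(3,4)
    by (intro lipschitz_on_joinpaths lipschitz_on_le[OF lipschitz_on_linepath]) simp_all
  show "path_image (linepath A M +++ linepath M B) \<subseteq> X"
    using assms by (simp add: path_image_join)
qed simp_all

section \<open>Removing a direction from the rows\<close>

lemma det_eq_0_iff_kernel:
  fixes A :: "real^'n^'n"
  shows "det A = 0 \<longleftrightarrow> (\<exists>v. norm v = 1 \<and> A *v v = 0)"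
proof
  assume "det A = 0"
  then have "\<not> (\<exists>B. B ** A = mat 1)"
    by (metis invertible_def invertible_det_nz matrix_left_right_inverse)
  then obtain v where v: "A *v v = 0" "v \<noteq> 0"
    using matrix_left_invertible_ker[of A] by auto
  then show "\<exists>v. norm v = 1 \<and> A *v v = 0"
    by (intro exI[of _ "v /\<^sub>R norm v"]) (simp add: matrix_vector_mult_scaleR)
next
  assume "\<exists>v. norm v = 1 \<and> A *v v = 0"
  then obtain v where "v \<noteq> 0" "A *v v = 0"
    by (metis norm_zero zero_neq_one)
  then have "\<not> (\<exists>B. B ** A = mat 1)"
    using matrix_left_invertible_ker[of A] by auto
  then show "det A = 0"
    by (metis invertible_def invertible_det_nz)
qed

text \<open>
  This is the product of \<open>A\<close> and \<open>I - s v v\<^sup>T\<close>. The form by rows makes it possible to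
  estimate norms row by row.
\<close>

definition shrink_rows :: "real \<Rightarrow> real^'n \<Rightarrow> real^'n^'m \<Rightarrow> real^'n^'m" where
  "shrink_rows s v A = (\<chi> i. A $ i - (s * (A $ i \<bullet> v)) *\<^sub>R v)"

lemma shrink_rows_eq_mult:
  "shrink_rows s v A = A ** (\<chi> k j. (if k = j then 1 else 0) - s * v $ k * v $ j)"
proof -
  have "(\<Sum>k\<in>UNIV. A $ i $ k * ((if k = j then 1 else 0) - s * v $ k * v $ j)) =
      A $ i $ j - s * (A $ i \<bullet> v) * v $ j" for i j
  proof -
    have "(\<Sum>k\<in>UNIV. A $ i $ k * ((if k = j then 1 else 0) - s * v $ k * v $ j)) =
        (\<Sum>k\<in>UNIV. (if k = j then A $ i $ k else 0) - s * v $ j * (A $ i $ k * v $ k))"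
      by (rule sum.cong) (auto simp: algebra_simps)
    also have "\<dots> = A $ i $ j - s * v $ j * (A $ i \<bullet> v)"
      by (simp add: sum_subtractf inner_vec_def flip: sum_distrib_left)
    finally show ?thesis by (simp add: mult_ac)
  qed
  then show ?thesis
    by (simp add: shrink_rows_def matrix_matrix_mult_def vec_eq_iff)
qed

lemma det_shrink_rows:
  fixes A :: "real^'n^'n"
  shows "det A = 0 \<Longrightarrow> det (shrink_rows s v A) = 0"
  by (simp add: shrink_rows_eq_mult det_mul)

lemma shrink_rows_1_kills:
  assumes "norm v = 1"
  shows "shrink_rows 1 v A *v v = 0"
  using assms
  by (simp add: shrink_rows_def vec_eq_iff matrix_vector_mul_component inner_diff_left norm_eq_1)

lemma segment_to_shrink_rows_singular:
  fixes A :: "real^'n^'n"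
  assumes "det A = 0"
  shows "closed_segment A (shrink_rows 1 v A) \<subseteq> determinantal_variety"
proof
  fix M assume "M \<in> closed_segment A (shrink_rows 1 v A)"
  then obtain s where "M = (1 - s) *\<^sub>R A + s *\<^sub>R shrink_rows 1 v A"
    by (auto simp: in_segment)
  then have "M = shrink_rows s v A"
    by (simp add: shrink_rows_def vec_eq_iff algebra_simps)
  then show "M \<in> determinantal_variety"
    using assms by (simp add: determinantal_variety_def det_shrink_rows)
qed

lemma segment_common_kernel_singular:
  fixes A B :: "real^'n^'n"
  assumes "norm v = 1" "A *v v = 0" "B *v v = 0"
  shows "closed_segment A B \<subseteq> determinantal_variety"
proof
  fix M assume "M \<in> closed_segment A B"
  then have "M *v v = 0"
    using assms by (auto simp: in_segment matrix_vector_mult_add_rdistrib scaleR_matrix_vector_assoc[symmetric])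
  then show "M \<in> determinantal_variety"
    using assms by (auto simp: determinantal_variety_def det_eq_0_iff_kernel)
qed

lemma norm_diff_projection_le:
  fixes x v :: "'a::real_inner"
  assumes "norm v = 1"
  shows "norm (x - (x \<bullet> v) *\<^sub>R v) \<le> norm x"
proof (rule power2_le_imp_le)
  have "(norm (x - (x \<bullet> v) *\<^sub>R v))\<^sup>2 = (norm x)\<^sup>2 - (x \<bullet> v)\<^sup>2"
    using assms unfolding power2_norm_eq_inner
    by (simp add: inner_diff inner_commute norm_eq_1 power2_eq_square)
  then show "(norm (x - (x \<bullet> v) *\<^sub>R v))\<^sup>2 \<le> (norm x)\<^sup>2" by simp
qed simp

text \<open>
  Since \<open>B v = 0\<close>, the products of \<open>v\<close> with the rows of \<open>A\<close> and of \<open>A - B\<close> agree. This is what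
  bounds the two segments by the distance from \<open>A\<close> to \<open>B\<close>, however large \<open>A\<close> is.
\<close>

lemma dist_shrink_rows_le:
  assumes v: "norm v = 1" and B: "B *v v = 0"
  shows "dist A (shrink_rows 1 v A) \<le> dist A B" "dist (shrink_rows 1 v A) B \<le> dist A B"
proof -
  have "B $ i \<bullet> v = 0" for i
    using B by (metis matrix_vector_mul_component zero_index)
  then have row: "A $ i \<bullet> v = (A - B) $ i \<bullet> v" for i
    by (simp add: inner_diff_left)
  show "dist A (shrink_rows 1 v A) \<le> dist A B"
    unfolding dist_norm
  proof (rule norm_le_componentwise_cart)
    fix i
    have "norm ((A - shrink_rows 1 v A) $ i) = \<bar>(A - B) $ i \<bullet> v\<bar>"
      using v row[of i] by (simp add: shrink_rows_def)
    also have "\<dots> \<le> norm ((A - B) $ i)"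
      using Cauchy_Schwarz_ineq2[of "(A - B) $ i" v] v by simp
    finally show "norm ((A - shrink_rows 1 v A) $ i) \<le> norm ((A - B) $ i)" .
  qed
  show "dist (shrink_rows 1 v A) B \<le> dist A B"
    unfolding dist_norm
  proof (rule norm_le_componentwise_cart)
    fix i
    have "(shrink_rows 1 v A - B) $ i = (A - B) $ i - ((A - B) $ i \<bullet> v) *\<^sub>R v"
      using row[of i] by (simp add: shrink_rows_def)
    then show "norm ((shrink_rows 1 v A - B) $ i) \<le> norm ((A - B) $ i)"
      using norm_diff_projection_le[OF v] by metis
  qed
qed

section \<open>Normal embedding\<close>

theorem mainTheorem2:
  shows "normally_embedded (determinantal_variety :: (real^'n^'n) set)"
proof -
  have "intrinsic_dist determinantal_variety A B \<le> ennreal (2 * dist A B)"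
    if A: "A \<in> determinantal_variety" and B: "B \<in> determinantal_variety" for A B :: "real^'n^'n"
  proof -
    obtain v where v: "norm v = 1" "B *v v = 0"
      using B by (auto simp: determinantal_variety_def det_eq_0_iff_kernel)
    show ?thesis
    proof (rule intrinsic_dist_two_segments)
      show "closed_segment A (shrink_rows 1 v A) \<subseteq> determinantal_variety"
        using A by (intro segment_to_shrink_rows_singular) (simp add: determinantal_variety_def)
      show "closed_segment (shrink_rows 1 v A) B \<subseteq> determinantal_variety"
        using v by (intro segment_common_kernel_singular[of v] shrink_rows_1_kills) auto
    qed (use dist_shrink_rows_le[OF v] in auto)
  qed
  then show ?thesis
    unfolding normally_embedded_def using dist_le_intrinsic_dist by (intro exI[of _ 2]) auto
qed

end
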